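(* Let $\mathcal{H}_N$ be a real or complex Hilbert space of finite dimension $N$. Let $\{W_i\}_{i=1}^M$ be subspaces of $\mathcal{H}_N$ which yield phase retrieval, but such that $\{W_i\}_{i\in I}$ fails phase retrieval for any $I\subset\{1,\dots,M\}$ with $|I|=M-1$. Let $I\subset\{1,\dots,M\}$ with $|I|=M-1$. If $\{f_{i,j}\}_{j=1}^{d_i}$ is an orthonormal basis for $W_i$ for all $i\in I$, and $I_1,I_2$ is a partition of the index set $\{(i,j): i\in I,\ 1\le j\le d_i\}$ such that for each $l=1,2$ the family $\{f_{i,j}\}_{(i,j)\in I_l}$ does not span $\mathcal{H}_N$, then \[\dim\left(\operatorname{span}\{f_{i,j}\}_{(i,j)\in I_1}\right)=\dim\left(\operatorname{span}\{f_{i,j}\}_{(i,j)\in I_2}\right)=N-1.\]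
   Context: A family of subspaces $\{W_i\}_{i\in I}$ of $\mathcal{H}$ does (yields) phase retrieval if, with $P_i$ the orthogonal projection onto $W_i$, whenever $x,y\in\mathcal{H}$ satisfy $\|P_ix\|=\|P_iy\|$ for all $i\in I$, then $x=cy$ for some scalar $c$ with $|c|=1$; otherwise it fails phase retrieval. *)

theory Defs
  imports Complex_Main
begin

text \<open>
  The scalar fields. The two instances are the reals and the complex numbers; by the
  Gelfand--Mazur theorem every instance is isometrically isomorphic to one of these, and
  the last axiom determines the conjugation. Here \<open>scaleR r 1\<close> is \<open>of_real r\<close>, which cannot
  be written inside a class specification.
\<close>

class real_or_complex = real_normed_field +
  fixes scalar_cnj :: "'a \<Rightarrow> 'a"
  assumes scalar_cnj_add: "scalar_cnj (a + b) = scalar_cnj a + scalar_cnj b"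
    and scalar_cnj_mult: "scalar_cnj (a * b) = scalar_cnj a * scalar_cnj b"
    and scalar_cnj_cnj: "scalar_cnj (scalar_cnj a) = a"
    and scalar_cnj_scaleR_one: "scalar_cnj (scaleR r 1) = scaleR r 1"
    and mult_scalar_cnj: "a * scalar_cnj a = scaleR ((norm a)\<^sup>2) 1"

instantiation real :: real_or_complex
begin

definition scalar_cnj_real :: "real \<Rightarrow> real" where
  "scalar_cnj_real a = a"

instance
  by standard (simp_all add: scalar_cnj_real_def power2_eq_square)

end

instantiation complex :: real_or_complex
begin

definition scalar_cnj_complex :: "complex \<Rightarrow> complex" where
  "scalar_cnj_complex = cnj"

instance
  by standard (simp_all add: scalar_cnj_complex_def complex_norm_square[symmetric] scaleR_conv_of_real)

end

text \<open>
  The inner product is linear in its first argument. Completeness is automatic in finite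
  dimension. The parameter \<open>Basis\<close> of the library locale is an arbitrary finite linear
  basis, unrelated to the inner product; it only expresses finite-dimensionality.
\<close>

locale findim_hilbert_space = finite_dimensional_vector_space scale Basis
  for scale :: "'k::real_or_complex \<Rightarrow> 'v::ab_group_add \<Rightarrow> 'v" and Basis :: "'v set" +
  fixes ip :: "'v \<Rightarrow> 'v \<Rightarrow> 'k"
  assumes ip_add_left: "ip (x + y) z = ip x z + ip y z"
    and ip_scale_left: "ip (scale c x) z = c * ip x z"
    and ip_commute: "ip x y = scalar_cnj (ip y x)"
    and ip_pos: "x \<noteq> 0 \<Longrightarrow> \<exists>r>0. ip x x = of_real r"
begin

definition vnorm :: "'v \<Rightarrow> real" where
  "vnorm x = sqrt (norm (ip x x))"

definition orth_proj :: "'v set \<Rightarrow> 'v \<Rightarrow> 'v" where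
  "orth_proj W x = (THE p. p \<in> W \<and> (\<forall>w\<in>W. ip (x - p) w = 0))"

definition phase_retrieval :: "'i set \<Rightarrow> ('i \<Rightarrow> 'v set) \<Rightarrow> bool" where
  "phase_retrieval I W \<longleftrightarrow>
     (\<forall>x y. (\<forall>i\<in>I. vnorm (orth_proj (W i) x) = vnorm (orth_proj (W i) y)) \<longrightarrow>
            (\<exists>c. norm c = 1 \<and> x = scale c y))"

definition orthonormal_basis :: "nat \<Rightarrow> (nat \<Rightarrow> 'v) \<Rightarrow> 'v set \<Rightarrow> bool" where
  "orthonormal_basis d f W \<longleftrightarrow>
     (\<forall>j\<in>{1..d}. \<forall>k\<in>{1..d}. ip (f j) (f k) = (if j = k then 1 else 0)) \<and>
     span (f ` {1..d}) = W"

text \<open>The description defining \<open>orth_proj\<close> is proper.\<close>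

lemma ip_zero_left [simp]: "ip 0 z = 0"
  using ip_add_left[of 0 0 z] by simp

lemma ip_diff_left: "ip (x - y) z = ip x z - ip y z"
  using ip_add_left[of "x - y" y z] by (simp add: algebra_simps)

lemma ip_zero_commute: "ip x y = 0 \<Longrightarrow> ip y x = 0"
  using ip_commute[of y x] scalar_cnj_scaleR_one[of 0, where ?'a = 'k] by simp

lemma ip_self_eq_zero: "ip x x = 0 \<Longrightarrow> x = 0"
  using ip_pos[of x] by auto

lemma ip_add_scale_right:
  assumes "ip u e = 0" and "ip u v = 0"
  shows "ip u (v + scale c e) = 0"
proof -
  have "ip (v + scale c e) u = 0"
    using ip_zero_commute[OF assms(1)] ip_zero_commute[OF assms(2)]
    by (simp add: ip_add_left ip_scale_left)
  then show ?thesis by (rule ip_zero_commute)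
qed

lemma orth_decomp_span:
  assumes "finite B"
  shows "\<exists>p\<in>span B. \<forall>w\<in>span B. ip (x - p) w = 0"
  using assms
proof (induction B arbitrary: x)
  case empty
  then show ?case
    using ip_zero_commute[OF ip_zero_left] by simp
next
  case (insert b B)
  obtain q where q: "q \<in> span B" "\<And>w. w \<in> span B \<Longrightarrow> ip (b - q) w = 0"
    using insert.IH[of b] by blast
  obtain p where p: "p \<in> span B" "\<And>w. w \<in> span B \<Longrightarrow> ip (x - p) w = 0"
    using insert.IH[of x] by blast
  define e where "e = b - q"
  define p' where "p' = p + scale (ip (x - p) e / ip e e) e"
  have sub: "span B \<subseteq> span (insert b B)"
    by (rule span_mono) blast
  have e_in: "e \<in> span (insert b B)"
    unfolding e_def using q(1) sub by (intro span_diff) (auto intro: span_base)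
  have diff: "x - p' = (x - p) - scale (ip (x - p) e / ip e e) e"
    by (simp add: p'_def algebra_simps)
  have perp_e: "ip (x - p') e = 0"
  proof (cases "e = 0")
    case True
    then show ?thesis using ip_zero_commute[OF ip_zero_left] by simp
  next
    case False
    then have "ip e e \<noteq> 0" using ip_self_eq_zero by blast
    then show ?thesis unfolding diff by (simp add: ip_diff_left ip_scale_left)
  qed
  have perp_B: "ip (x - p') w = 0" if "w \<in> span B" for w
    unfolding diff using p(2)[OF that] q(2)[OF that]
    by (simp add: ip_diff_left ip_scale_left e_def)
  have "ip (x - p') w = 0" if w: "w \<in> span (insert b B)" for w
  proof -
    obtain k where k: "w - scale k b \<in> span B"
      using w span_breakdown_eq by blast
    define v where "v = (w - scale k b) + scale k q"
    have v: "v \<in> span B"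
      unfolding v_def using k q(1) by (intro span_add span_scale)
    have "w = v + scale k e"
      by (simp add: v_def e_def scale_right_diff_distrib)
    then show ?thesis
      using ip_add_scale_right[OF perp_e perp_B[OF v]] by simp
  qed
  moreover have "p' \<in> span (insert b B)"
    unfolding p'_def using p(1) sub e_in by (intro span_add span_scale) auto
  ultimately show ?case by blast
qed

lemma orth_proj_ex1:
  assumes "subspace W"
  shows "\<exists>!p. p \<in> W \<and> (\<forall>w\<in>W. ip (x - p) w = 0)"
proof (rule ex_ex1I)
  obtain B where "B \<subseteq> W" "independent B" "W \<subseteq> span B"
    using basis_exists[of W] by metis
  moreover from this have "span B = W"
    using assms span_minimal by blast
  ultimately show "\<exists>p. p \<in> W \<and> (\<forall>w\<in>W. ip (x - p) w = 0)"
    using orth_decomp_span[of B x] finiteI_independent by blast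
next
  fix p p'
  assume p: "p \<in> W \<and> (\<forall>w\<in>W. ip (x - p) w = 0)"
    and p': "p' \<in> W \<and> (\<forall>w\<in>W. ip (x - p') w = 0)"
  have d: "p - p' \<in> W" using p p' assms subspace_diff by blast
  have "p - p' = (x - p') - (x - p)" by simp
  then have "ip (p - p') (p - p') = 0"
    using p p' d by (metis ip_diff_left diff_self)
  then show "p = p'" using ip_self_eq_zero by fastforce
qed

end

end

theory Submission
  imports Defs
begin

text \<open>
  The whole argument rests on one obstruction to phase retrieval: if \<open>u\<close> and \<open>v\<close> are non-zero
  and \<open>\<langle>u, P\<^sub>i v\<rangle> = 0\<close> for every \<open>i\<close>, then each \<open>P\<^sub>i u\<close> is orthogonal to \<open>P\<^sub>i v\<close>, so by Pythagoras
  \<open>u + v\<close> and \<open>u - v\<close> have the same measurements although they are not multiples of each other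
  by a scalar of modulus one, apart from a degenerate case in which \<open>v\<close> itself is
  indistinguishable from \<open>0\<close> (\<open>phase_retrieval_no_orthogonal_pair\<close>).

  Such a pair arises as follows. Let \<open>S\<close> and \<open>T\<close> be the two parts of the union of the orthonormal
  bases, and let \<open>k\<close> be the index that does not belong to \<open>I\<close>. Since \<open>T\<close> does not span, some
  \<open>v \<noteq> 0\<close> is orthogonal to \<open>T\<close>. For \<open>i \<in> I\<close> the vector \<open>P\<^sub>i v\<close> then lies in the span of \<open>S\<close>, because
  its coefficients at the basis vectors in \<open>T\<close> vanish. If the span of \<open>S\<close> had codimension at
  least two, then \<open>S\<close> together with the single vector \<open>P\<^sub>k v\<close> would still not span, and some
  \<open>u \<noteq> 0\<close> orthogonal to all of these would satisfy \<open>\<langle>u, P\<^sub>i v\<rangle> = 0\<close> for every \<open>i\<close>. Hence \<open>S\<close> spans a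
  hyperplane, and by symmetry so does \<open>T\<close>.
\<close>

context findim_hilbert_space
begin

lemma ip_zero_right [simp]: "ip z 0 = 0"
  using ip_zero_commute[OF ip_zero_left] .

lemma orth_proj_works:
  assumes "subspace W"
  shows orth_proj_mem: "orth_proj W x \<in> W"
    and orth_proj_perp: "w \<in> W \<Longrightarrow> ip (x - orth_proj W x) w = 0"
  using theI'[OF orth_proj_ex1[OF assms, of x]] unfolding orth_proj_def by blast+

lemma orth_proj_eqI:
  assumes "subspace W" "p \<in> W" "\<And>w. w \<in> W \<Longrightarrow> ip (x - p) w = 0"
  shows "orth_proj W x = p"
  unfolding orth_proj_def using assms(2,3) by (intro the1_equality orth_proj_ex1 assms(1)) simp

lemma orth_proj_add:
  assumes "subspace W"
  shows "orth_proj W (x + y) = orth_proj W x + orth_proj W y"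
proof (rule orth_proj_eqI[OF assms])
  show "orth_proj W x + orth_proj W y \<in> W"
    by (intro subspace_add assms orth_proj_mem)
  fix w assume w: "w \<in> W"
  have "x + y - (orth_proj W x + orth_proj W y) = (x - orth_proj W x) + (y - orth_proj W y)"
    by simp
  then show "ip (x + y - (orth_proj W x + orth_proj W y)) w = 0"
    using orth_proj_perp[OF assms w] by (simp only: ip_add_left add_0)
qed

lemma orth_proj_zero: "subspace W \<Longrightarrow> orth_proj W 0 = 0"
  by (rule orth_proj_eqI) (auto simp: subspace_0)

lemma orth_proj_diff:
  assumes "subspace W"
  shows "orth_proj W (x - y) = orth_proj W x - orth_proj W y"
  using orth_proj_add[OF assms, of "x - y" y] by (simp add: algebra_simps)

lemma ip_orth_proj:
  assumes "subspace W"
  shows "ip (orth_proj W x) (orth_proj W y) = ip x (orth_proj W y)"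
  using orth_proj_perp[OF assms orth_proj_mem[OF assms], of x y] by (simp add: ip_diff_left)

lemma ip_span_right_zero:
  assumes "\<And>s. s \<in> S \<Longrightarrow> ip u s = 0" and "w \<in> span S"
  shows "ip u w = 0"
  using assms(2)
proof (induction rule: span_induct_alt)
  case base
  show ?case by simp
next
  case (step c x y)
  then show ?case
    using ip_add_scale_right[of u x y c] assms(1) by (simp add: add.commute)
qed

lemma exists_orthogonal_to_proper_span:
  assumes "span S \<noteq> UNIV"
  obtains u where "u \<noteq> 0" "\<And>s. s \<in> S \<Longrightarrow> ip u s = 0"
proof -
  obtain x where x: "x \<notin> span S" using assms by blast
  show ?thesis
  proof (rule that)
    show "x - orth_proj (span S) x \<noteq> 0"
      using x orth_proj_mem[OF subspace_span, of S x] by auto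
    show "ip (x - orth_proj (span S) x) s = 0" if "s \<in> S" for s
      using orth_proj_perp[OF subspace_span] span_base[OF that] .
  qed
qed

lemma vnorm_add_eq_vnorm_diff:
  assumes "ip a b = 0"
  shows "vnorm (a + b) = vnorm (a - b)"
proof -
  have ba: "ip b a = 0" using assms by (rule ip_zero_commute)
  have neg: "ip z (- b) = - ip z b" for z
  proof -
    have "ip (- b) z = - ip b z"
      using ip_diff_left[of 0 b z] by simp
    moreover have "scalar_cnj (- t) = - scalar_cnj t" for t :: 'k
      using scalar_cnj_add[of t "- t"] scalar_cnj_scaleR_one[of 0, where ?'a = 'k]
      by (simp add: eq_neg_iff_add_eq_0 add.commute)
    ultimately show ?thesis
      using ip_commute[of z "- b"] ip_commute[of z b] by simp
  qed
  have add: "ip z (a + w) = ip z a + ip z w" for z w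
    using ip_commute[of z "a + w"] ip_commute[of z a] ip_commute[of z w]
    by (simp add: ip_add_left scalar_cnj_add)
  have "ip (a + b) (a + b) = ip (a - b) (a - b)"
    using add[of "a - b" "- b"] neg[of "a - b"] assms ba
    by (simp add: add ip_add_left ip_diff_left)
  then show ?thesis by (simp add: vnorm_def)
qed

text \<open>
  The vectors \<open>u + v\<close> and \<open>u - v\<close> cannot be told apart, since \<open>P\<^sub>i u\<close> is orthogonal to \<open>P\<^sub>i v\<close> for
  every \<open>i\<close>. Over the reals this would already force \<open>u = 0\<close> or \<open>v = 0\<close>; over the complex numbers
  \<open>u\<close> may also be a non-zero multiple of \<open>v\<close> (for instance \<open>u = \<i>v\<close>). In that case \<open>P\<^sub>i v\<close> is
  orthogonal to itself, so that \<open>v\<close> cannot be told apart from \<open>0\<close>.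
\<close>

lemma phase_retrieval_no_orthogonal_pair:
  assumes pr: "phase_retrieval I W"
    and sub: "\<And>i. i \<in> I \<Longrightarrow> subspace (W i)"
    and orth: "\<And>i. i \<in> I \<Longrightarrow> ip u (orth_proj (W i) v) = 0"
  shows "u = 0 \<or> v = 0"
proof (rule ccontr)
  assume "\<not> (u = 0 \<or> v = 0)"
  then have u: "u \<noteq> 0" and v: "v \<noteq> 0" by auto
  have "vnorm (orth_proj (W i) (u + v)) = vnorm (orth_proj (W i) (u - v))" if i: "i \<in> I" for i
    unfolding orth_proj_add[OF sub[OF i]] orth_proj_diff[OF sub[OF i]]
    using orth[OF i] by (intro vnorm_add_eq_vnorm_diff) (simp add: ip_orth_proj sub[OF i])
  then obtain c where c: "u + v = scale c (u - v)"
    using pr unfolding phase_retrieval_def by blast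
  then have rel: "scale (c - 1) u = scale (c + 1) v"
    by (simp add: algebra_simps)
  have "c \<noteq> 1" using rel v by auto
  define l where "l = (c + 1) / (c - 1)"
  have "scale (c - 1) u = scale (c - 1) (scale l v)"
    using rel \<open>c \<noteq> 1\<close> by (simp add: l_def)
  then have ul: "u = scale l v"
    by (rule scale_left_imp_eq[rotated]) (simp add: \<open>c \<noteq> 1\<close>)
  then have "l \<noteq> 0" using u by auto
  have "orth_proj (W i) v = 0" if i: "i \<in> I" for i
    using orth[OF i] \<open>l \<noteq> 0\<close> ip_orth_proj[OF sub[OF i], of v v]
    by (intro ip_self_eq_zero) (simp add: ul ip_scale_left)
  then have "\<forall>i\<in>I. vnorm (orth_proj (W i) v) = vnorm (orth_proj (W i) 0)"
    using sub by (simp add: orth_proj_zero)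
  then obtain c' where "v = scale c' 0"
    using pr unfolding phase_retrieval_def by blast
  then show False using v by simp
qed

text \<open>
  The projection of \<open>v\<close> onto the span of \<open>S\<close> is already its projection onto the span of
  \<open>S \<union> T\<close>: the error is orthogonal to \<open>S\<close> by construction, and to \<open>T\<close> because both \<open>v\<close> and
  the span of \<open>S\<close> are.
\<close>

lemma orth_proj_mem_span_orthogonal_part:
  assumes ST: "\<And>s t. s \<in> S \<Longrightarrow> t \<in> T \<Longrightarrow> ip t s = 0"
    and v: "\<And>t. t \<in> T \<Longrightarrow> ip v t = 0"
  shows "orth_proj (span (S \<union> T)) v \<in> span S"
proof -
  let ?p = "orth_proj (span S) v"
  have p: "?p \<in> span S" by (rule orth_proj_mem) simp
  have perp: "ip (v - ?p) s = 0" if "s \<in> S \<union> T" for s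
    using that
  proof
    assume "s \<in> S"
    then show ?thesis by (intro orth_proj_perp) (auto intro: span_base)
  next
    assume s: "s \<in> T"
    have "ip s ?p = 0"
      using ip_span_right_zero[OF _ p, of s] ST s by blast
    then show ?thesis
      using v[OF s] ip_zero_commute by (simp add: ip_diff_left)
  qed
  have "orth_proj (span (S \<union> T)) v = ?p"
  proof (rule orth_proj_eqI)
    show "?p \<in> span (S \<union> T)"
      using p span_mono[of S "S \<union> T"] by blast
    show "ip (v - ?p) w = 0" if "w \<in> span (S \<union> T)" for w
      using ip_span_right_zero[OF perp that] .
  qed simp
  then show ?thesis using p by simp
qed

lemma orthonormal_basis_orth_proj_mem_span:
  assumes onb: "orthonormal_basis d e W"
    and JK: "J \<union> K = {1..d}" "J \<inter> K = {}"
    and v: "\<And>j. j \<in> K \<Longrightarrow> ip v (e j) = 0"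
  shows "orth_proj W v \<in> span (e ` J)"
proof -
  have "W = span (e ` J \<union> e ` K)"
    using onb JK(1) by (simp add: orthonormal_basis_def image_Un[symmetric])
  moreover have "ip t s = 0" if st: "s \<in> e ` J" "t \<in> e ` K" for s t
  proof -
    obtain j k where "s = e j" "t = e k" "j \<in> J" "k \<in> K" using st by blast
    moreover from this have "j \<noteq> k" "j \<in> {1..d}" "k \<in> {1..d}" using JK by blast+
    ultimately show ?thesis using onb by (simp add: orthonormal_basis_def)
  qed
  ultimately show ?thesis
    using orth_proj_mem_span_orthogonal_part[of "e ` J" "e ` K" v] v by blast
qed

text \<open>
  One vector is all that the additional subspace \<open>W k\<close> contributes: fix \<open>v \<noteq> 0\<close> orthogonal to the
  second part. The first part enlarged by \<open>P\<^sub>k v\<close> has to span, as otherwise some \<open>u \<noteq> 0\<close> orthogonal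
  to it would contradict \<open>phase_retrieval_no_orthogonal_pair\<close>. Removing \<open>P\<^sub>k v\<close> again lowers the
  dimension by at most one.
\<close>

lemma dim_span_part_of_bases:
  fixes f :: "'i \<Rightarrow> nat \<Rightarrow> 'v"
  assumes pr: "phase_retrieval (insert k I) W"
    and sub: "\<And>i. i \<in> insert k I \<Longrightarrow> subspace (W i)"
    and onb: "\<And>i. i \<in> I \<Longrightarrow> orthonormal_basis (d i) (f i) (W i)"
    and part: "I1 \<union> I2 = Sigma I (\<lambda>i. {1..d i})" "I1 \<inter> I2 = {}"
    and proper1: "span ((\<lambda>(i, j). f i j) ` I1) \<noteq> UNIV"
    and proper2: "span ((\<lambda>(i, j). f i j) ` I2) \<noteq> UNIV"
  shows "dim (span ((\<lambda>(i, j). f i j) ` I1)) = dim UNIV - 1"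
proof -
  define S where "S = (\<lambda>(i, j). f i j) ` I1"
  obtain v where v: "v \<noteq> 0" and v_perp: "\<And>t. t \<in> (\<lambda>(i, j). f i j) ` I2 \<Longrightarrow> ip v t = 0"
    using exists_orthogonal_to_proper_span[OF proper2] by blast
  have proj: "orth_proj (W i) v \<in> span S" if i: "i \<in> I" for i
  proof -
    have "orth_proj (W i) v \<in> span (f i ` (I1 `` {i}))"
    proof (rule orthonormal_basis_orth_proj_mem_span[OF onb[OF i]])
      show "I1 `` {i} \<union> I2 `` {i} = {1..d i}"
        using part(1) i by (auto simp flip: Un_Image)
      show "I1 `` {i} \<inter> I2 `` {i} = {}" using part(2) by blast
      show "ip v (f i j) = 0" if "j \<in> I2 `` {i}" for j
        using v_perp that by force
    qed
    moreover have "f i ` (I1 `` {i}) \<subseteq> S" by (force simp: S_def)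
    ultimately show ?thesis using span_mono by blast
  qed
  have spans: "span (insert (orth_proj (W k) v) S) = UNIV"
  proof (rule ccontr)
    assume "span (insert (orth_proj (W k) v) S) \<noteq> UNIV"
    then obtain u where u: "u \<noteq> 0"
      and u_perp: "\<And>s. s \<in> insert (orth_proj (W k) v) S \<Longrightarrow> ip u s = 0"
      using exists_orthogonal_to_proper_span by blast
    have "ip u (orth_proj (W i) v) = 0" if "i \<in> insert k I" for i
      using that u_perp proj ip_span_right_zero[of S u] by blast
    then show False
      using phase_retrieval_no_orthogonal_pair[OF pr sub] u v by blast
  qed
  have "dim UNIV \<le> dim S + 1"
    using dim_insert[of "orth_proj (W k) v" S] spans dim_span[of "insert (orth_proj (W k) v) S"]
    by (simp split: if_splits)
  moreover have "dim S \<noteq> dim UNIV"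
    using proper1 dim_eq_full[of S] by (simp add: S_def dim_UNIV dimension_def)
  moreover have "dim S \<le> dim UNIV"
    by (rule dim_subset) simp
  ultimately show ?thesis
    unfolding S_def[symmetric] dim_span by linarith
qed

end

theorem theorem5p1:
  fixes scale :: "'k::real_or_complex \<Rightarrow> 'v::ab_group_add \<Rightarrow> 'v"
    and Basis :: "'v set"
    and ip :: "'v \<Rightarrow> 'v \<Rightarrow> 'k"
    and W :: "nat \<Rightarrow> 'v set"
    and f :: "nat \<Rightarrow> nat \<Rightarrow> 'v"
    and d :: "nat \<Rightarrow> nat"
    and M N :: nat
    and I :: "nat set"
    and I1 I2 :: "(nat \<times> nat) set"
  assumes "findim_hilbert_space scale Basis ip"
    and "vector_space.dim scale (UNIV :: 'v set) = N"
    and "\<forall>i\<in>{1..M}. module.subspace scale (W i)"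
    and "findim_hilbert_space.phase_retrieval scale ip {1..M} W"
    and "\<forall>J. J \<subseteq> {1..M} \<and> card J + 1 = M \<longrightarrow>
           \<not> findim_hilbert_space.phase_retrieval scale ip J W"
    and "I \<subseteq> {1..M}"
    and "card I + 1 = M"
    and "\<forall>i\<in>I. findim_hilbert_space.orthonormal_basis scale ip (d i) (f i) (W i)"
    and "I1 \<union> I2 = {(i, j). i \<in> I \<and> 1 \<le> j \<and> j \<le> d i}"
    and "I1 \<inter> I2 = {}"
    and "module.span scale ((\<lambda>(i, j). f i j) ` I1) \<noteq> UNIV"
    and "module.span scale ((\<lambda>(i, j). f i j) ` I2) \<noteq> UNIV"
  shows "vector_space.dim scale (module.span scale ((\<lambda>(i, j). f i j) ` I1)) = N - 1
       \<and> vector_space.dim scale (module.span scale ((\<lambda>(i, j). f i j) ` I2)) = N - 1"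
proof -
  interpret findim_hilbert_space scale Basis ip by fact
  have "finite I" using assms(6) finite_subset by blast
  have "card ({1..M} - I) = 1"
    using card_Diff_subset[OF \<open>finite I\<close> assms(6)] assms(7) by simp
  then obtain k where k: "{1..M} - I = {k}" by (auto simp: card_1_singleton_iff)
  have ins: "{1..M} = insert k I" using k assms(6) by blast
  have part: "I1 \<union> I2 = Sigma I (\<lambda>i. {1..d i})" using assms(9) by auto
  note hyperplane = dim_span_part_of_bases[OF assms(4)[unfolded ins]
    bspec[OF assms(3)[unfolded ins]] bspec[OF assms(8)], unfolded assms(2)]
  show ?thesis
    using hyperplane[OF _ _ part assms(10-12)]
      hyperplane[OF _ _ part[unfolded Un_commute[of I1]] assms(10)[unfolded Int_commute[of I1]]
        assms(12,11)]
    by blast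
qed

end
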